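(* Let $G=(V,E,W)$ and $\widetilde G=(\widetilde V,\widetilde E,\widetilde W)$ be weighted, connected graphs with $|V|=|\widetilde V|=n$, let $\lambda_1^*=\max\{\lambda_1,\widetilde\lambda_1\}$, and let $\mathbf{M}=\mathbf{I}$ so that $\mathbf{K}=\mathbf{T}$. Let $\mathcal{W}^{(1)}_J$ be the wavelets constructed from $\mathbf{T}$ and let $\widetilde{\mathcal{W}}^{(1)}_J$ be the corresponding wavelets on $\widetilde G$ constructed from $\widetilde{\mathbf{T}}$. Then there exists a constant $C_{\lambda_1^*}$, depending only on $\lambda_1^*$, such that $$\big\|\mathcal{W}^{(1)}_J-\widetilde{\mathcal{W}}^{(1)}_J\big\|_2^2\le C_{\lambda_1^*}\,2^J\,n\,\|\mathbf{T}-\widetilde{\mathbf{T}}\|_2 .$$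
   Context: For a weighted, connected (undirected) graph on $\{0,\dots,n-1\}$ with weighted adjacency matrix $\mathbf{A}$, weighted degree vector $\mathbf{d}$ and $\mathbf{D}=\mathrm{diag}(\mathbf{d})$, let $\mathbf{N}=\mathbf{I}-\mathbf{D}^{-1/2}\mathbf{A}\mathbf{D}^{-1/2}$ have eigenvalues $0=\omega_0<\omega_1\le\dots\le\omega_{n-1}\le 2$ and orthonormal eigenbasis $\mathbf{v}_0,\dots,\mathbf{v}_{n-1}$, with $\mathbf{v}_0=\mathbf{d}^{1/2}/\|\mathbf{d}^{1/2}\|_2$, and let $\mathbf{V}$ be the orthogonal matrix with columns $\mathbf{v}_i$. Fix a monotonically decreasing $g:[0,2]\to[0,1]$ with $g(0)=1$, $g(2)=0$; put $\lambda_i=g(\omega_i)$, so $1=\lambda_0>\lambda_1\ge\dots\ge\lambda_{n-1}\ge 0$, $\Lambda=\mathrm{diag}(\lambda_0,\dots,\lambda_{n-1})$ and $\mathbf{T}=\mathbf{V}\Lambda\mathbf{V}^T$. Objects with a tilde are the analogous objects for $\widetilde G$ (with the same $g$). For an integer $J\ge0$ let $p_0(t)=1-t$, $p_j(t)=t^{2^{j-1}}-t^{2^j}$ for $1\le j\le J$, $p_{J+1}(t)=t^{2^J}$, and $q_j=p_j^{1/2}$ on $[0,1]$; $q_j(\mathbf{T})=\mathbf{V}q_j(\Lambda)\mathbf{V}^T$ with $q_j$ applied to the diagonal entries. Here (with $\mathbf{M}=\mathbf{I}$) $\mathcal{W}^{(1)}_J=\{q_j(\mathbf{T})\}_{0\le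 j\le J+1}$ and $\widetilde{\mathcal{W}}^{(1)}_J=\{q_j(\widetilde{\mathbf{T}})\}_{0\le j\le J+1}$. For a family of matrices, $\|\{\mathbf{B}_i\}_i\|_2=\sup_{\|\mathbf{x}\|_2=1}\big(\sum_i\|\mathbf{B}_i\mathbf{x}\|_2^2\big)^{1/2}$, and differences of families are taken elementwise; for a single matrix $\|\cdot\|_2$ is the Euclidean operator norm. *)

theory Defs
  imports Complex_Main "Jordan_Normal_Form.Char_Poly"
begin

(* The sets below are nonempty and bounded above when n \<ge> 1, I is finite and the matrices lie
   in carrier_mat n n, so Sup is then the genuine supremum. *)

definition vec_norm2 :: "real vec \<Rightarrow> real" where
  "vec_norm2 x = sqrt (x \<bullet> x)"

definition op_norm2 :: "nat \<Rightarrow> real mat \<Rightarrow> real" where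
  "op_norm2 n B = (SUP x \<in> {x \<in> carrier_vec n. vec_norm2 x = 1}. vec_norm2 (B *\<^sub>v x))"

definition family_norm2 :: "nat \<Rightarrow> 'i set \<Rightarrow> ('i \<Rightarrow> real mat) \<Rightarrow> real" where
  "family_norm2 n I B =
     (SUP x \<in> {x \<in> carrier_vec n. vec_norm2 x = 1}.
        sqrt (\<Sum>i\<in>I. (vec_norm2 (B i *\<^sub>v x))\<^sup>2))"

(* An undirected edge is represented by both of its orientations. Loops are not excluded. *)
definition weighted_connected_graph ::
    "nat \<Rightarrow> (nat \<times> nat) set \<Rightarrow> (nat \<Rightarrow> nat \<Rightarrow> real) \<Rightarrow> bool" where
  "weighted_connected_graph n E W \<longleftrightarrow>
     E \<subseteq> {..<n} \<times> {..<n} \<and> sym E \<and>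
     (\<forall>(i, j) \<in> E. W i j > 0 \<and> W i j = W j i) \<and>
     (\<forall>i<n. \<forall>j<n. (i, j) \<in> E\<^sup>*)"

definition weighted_adjacency ::
    "nat \<Rightarrow> (nat \<times> nat) set \<Rightarrow> (nat \<Rightarrow> nat \<Rightarrow> real) \<Rightarrow> real mat" where
  "weighted_adjacency n E W = mat n n (\<lambda>(i, j). if (i, j) \<in> E then W i j else 0)"

definition weighted_degree ::
    "nat \<Rightarrow> (nat \<times> nat) set \<Rightarrow> (nat \<Rightarrow> nat \<Rightarrow> real) \<Rightarrow> real vec" where
  "weighted_degree n E W = vec n (\<lambda>i. \<Sum>j<n. weighted_adjacency n E W $$ (i, j))"

definition normalized_laplacian ::
    "nat \<Rightarrow> (nat \<times> nat) set \<Rightarrow> (nat \<Rightarrow> nat \<Rightarrow> real) \<Rightarrow> real mat" where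
  "normalized_laplacian n E W =
     (let Dinv = mat_diag n (\<lambda>i. 1 / sqrt (weighted_degree n E W $ i))
      in 1\<^sub>m n - Dinv * weighted_adjacency n E W * Dinv)"

definition sqrt_degree ::
    "nat \<Rightarrow> (nat \<times> nat) set \<Rightarrow> (nat \<Rightarrow> nat \<Rightarrow> real) \<Rightarrow> real vec" where
  "sqrt_degree n E W = map_vec sqrt (weighted_degree n E W)"

(* The columns of V are the eigenvectors v_0, ..., v_(n-1) and \<omega> lists their eigenvalues in
   increasing order. That \<omega> 0 = 0, that \<omega> 1 > 0 and that all values lie in [0,2] are theorems
   about connected graphs and not part of the definition. *)
definition laplacian_eigenbasis ::
    "nat \<Rightarrow> (nat \<times> nat) set \<Rightarrow> (nat \<Rightarrow> nat \<Rightarrow> real) \<Rightarrow> (nat \<Rightarrow> real) \<Rightarrow> real mat \<Rightarrow> bool" where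
  "laplacian_eigenbasis n E W \<omega> V \<longleftrightarrow>
     V \<in> carrier_mat n n \<and> transpose_mat V * V = 1\<^sub>m n \<and>
     (\<forall>i<n. eigenvector (normalized_laplacian n E W) (col V i) (\<omega> i)) \<and>
     (\<forall>i j. i \<le> j \<longrightarrow> j < n \<longrightarrow> \<omega> i \<le> \<omega> j) \<and>
     col V 0 = (1 / vec_norm2 (sqrt_degree n E W)) \<cdot>\<^sub>v sqrt_degree n E W"

(* Decreasing is meant in the weak sense. The last condition is what \<lambda>_1 < \<lambda>_0 = 1 needs; it is
   automatic when g is strictly decreasing. *)
definition spectral_profile :: "(real \<Rightarrow> real) \<Rightarrow> bool" where
  "spectral_profile g \<longleftrightarrow>
     g ` {0..2} \<subseteq> {0..1} \<and> antimono_on {0..2} g \<and> g 0 = 1 \<and> g 2 = 0 \<and>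
     (\<forall>t \<in> {0<..2}. g t < 1)"

definition spectral_mat :: "nat \<Rightarrow> real mat \<Rightarrow> (nat \<Rightarrow> real) \<Rightarrow> real mat" where
  "spectral_mat n V \<mu> = V * mat_diag n \<mu> * transpose_mat V"

definition wavelet_p :: "nat \<Rightarrow> nat \<Rightarrow> real \<Rightarrow> real" where
  "wavelet_p J j t =
     (if j = 0 then 1 - t
      else if j \<le> J then t ^ (2 ^ (j - 1)) - t ^ (2 ^ j)
      else t ^ (2 ^ J))"

definition wavelet_q :: "nat \<Rightarrow> nat \<Rightarrow> real \<Rightarrow> real" where
  "wavelet_q J j t = sqrt (wavelet_p J j t)"

(* The family W_J^(1); its index j ranges over {..J + 1}. *)
definition wavelets :: "nat \<Rightarrow> real mat \<Rightarrow> (nat \<Rightarrow> real) \<Rightarrow> nat \<Rightarrow> nat \<Rightarrow> real mat" where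
  "wavelets n V lam J j = spectral_mat n V (\<lambda>i. wavelet_q J j (lam i))"

end

theory Submission
  imports Defs "HOL-Analysis.Convex"
begin

text \<open>
  With \<open>C = V\<^sup>T V'\<close>, the matrix \<open>V\<^sup>T (f(T) - f(T')) V'\<close> has entries
  \<open>(f(\<lambda>\<^sub>i) - f(\<lambda>'\<^sub>k)) C\<^sub>i\<^sub>k\<close>, and the squares \<open>C\<^sub>i\<^sub>k\<^sup>2\<close> form a doubly stochastic matrix.
  For \<open>f = id\<close> every column of it has norm at most \<open>\<parallel>T - T'\<parallel>\<close>, so Cauchy--Schwarz in each
  column gives \<open>\<Sum>\<^sub>i\<^sub>k \<bar>\<lambda>\<^sub>i - \<lambda>'\<^sub>k\<bar> C\<^sub>i\<^sub>k\<^sup>2 \<le> n \<parallel>T - T'\<parallel>\<close>. For \<open>f = q\<^sub>j\<close> the operator norm is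
  bounded by the Frobenius norm, and
  \<open>(q\<^sub>j(s) - q\<^sub>j(t))\<^sup>2 \<le> \<bar>p\<^sub>j(s) - p\<^sub>j(t)\<bar>\<close> sums over \<open>j\<close> to at most
  \<open>4 * 2\<^sup>J * \<bar>s - t\<bar>\<close>. The constant can thus be taken to be \<open>4\<close>, whatever the spectral gap.
\<close>

section \<open>Scalar estimates for the wavelet functions on the unit interval\<close>

lemma wavelet_p_nonneg:
  assumes "0 \<le> t" "t \<le> 1"
  shows "0 \<le> wavelet_p J j t"
proof -
  have "t ^ (2 ^ j) \<le> t ^ (2 ^ (j - 1))"
    by (rule power_decreasing) (use assms in auto)
  then show ?thesis
    using assms by (auto simp: wavelet_p_def)
qed

text \<open>On the unit interval \<open>t ^ m\<close> is Lipschitz with constant \<open>m\<close>,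
  so for positive \<open>j\<close> the two powers contribute \<open>2 ^ (j - 1) + 2 ^ j\<close>,
  which is \<open>3 / 2 * 2 ^ j\<close>. The single power at index \<open>J + 1\<close> is treated
  separately.\<close>

lemma wavelet_p_Lipschitz:
  assumes s: "0 \<le> s" "s \<le> 1" and t: "0 \<le> t" "t \<le> 1" and j: "j \<le> J"
  shows "\<bar>wavelet_p J j s - wavelet_p J j t\<bar> \<le> 3 / 2 * 2 ^ j * \<bar>s - t\<bar>"
proof (cases j)
  case 0
  then show ?thesis by (simp add: wavelet_p_def abs_minus_commute[of t])
next
  case (Suc k)
  have pow: "\<bar>s ^ m - t ^ m\<bar> \<le> real m * \<bar>s - t\<bar>" for m
    using norm_power_diff[of s t m] s t by simp
  have "\<bar>wavelet_p J j s - wavelet_p J j t\<bar>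
      \<le> \<bar>s ^ (2 ^ k) - t ^ (2 ^ k)\<bar> + \<bar>s ^ (2 ^ Suc k) - t ^ (2 ^ Suc k)\<bar>"
    using Suc j by (simp add: wavelet_p_def)
  also have "\<dots> \<le> real (2 ^ k) * \<bar>s - t\<bar> + real (2 ^ Suc k) * \<bar>s - t\<bar>"
    by (intro add_mono pow)
  also have "\<dots> = 3 / 2 * 2 ^ j * \<bar>s - t\<bar>"
    using Suc by (simp add: algebra_simps)
  finally show ?thesis .
qed

text \<open>The square root is not Lipschitz at 0, but the family norm sums squares, so Hoelder
  continuity of order 1/2 is enough. It comes from factoring \<open>a - b\<close> and bounding the
  difference of the roots by their sum.\<close>

lemma sqrt_diff_square_le:
  fixes a b :: real
  assumes "0 \<le> a" "0 \<le> b"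
  shows "(sqrt a - sqrt b)\<^sup>2 \<le> \<bar>a - b\<bar>"
proof -
  have "(sqrt a - sqrt b)\<^sup>2 = \<bar>sqrt a - sqrt b\<bar> * \<bar>sqrt a - sqrt b\<bar>"
    by (simp add: power2_eq_square)
  also have "\<dots> \<le> \<bar>sqrt a - sqrt b\<bar> * \<bar>sqrt a + sqrt b\<bar>"
    by (rule mult_left_mono) (use real_sqrt_ge_zero[OF assms(1)] real_sqrt_ge_zero[OF assms(2)] in linarith)+
  also have "\<dots> = \<bar>(sqrt a - sqrt b) * (sqrt a + sqrt b)\<bar>"
    by (rule abs_mult[symmetric])
  also have "(sqrt a - sqrt b) * (sqrt a + sqrt b) = a - b"
    using assms by (simp add: algebra_simps)
  finally show ?thesis .
qed

lemma wavelet_q_square_Lipschitz: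
  assumes s: "0 \<le> s" "s \<le> 1" and t: "0 \<le> t" "t \<le> 1"
  shows "(\<Sum>j\<le>J + 1. (wavelet_q J j s - wavelet_q J j t)\<^sup>2) \<le> 4 * 2 ^ J * \<bar>s - t\<bar>"
proof -
  have "(\<Sum>j\<le>J + 1. (wavelet_q J j s - wavelet_q J j t)\<^sup>2)
      \<le> (\<Sum>j\<le>J + 1. \<bar>wavelet_p J j s - wavelet_p J j t\<bar>)"
    unfolding wavelet_q_def
    by (intro sum_mono sqrt_diff_square_le wavelet_p_nonneg s t)
  also have "\<dots> = (\<Sum>j\<le>J. \<bar>wavelet_p J j s - wavelet_p J j t\<bar>) + \<bar>s ^ (2 ^ J) - t ^ (2 ^ J)\<bar>"
    by (simp add: wavelet_p_def)
  also have "\<dots> \<le> (\<Sum>j\<le>J. 3 / 2 * 2 ^ j * \<bar>s - t\<bar>) + real (2 ^ J) * \<bar>s - t\<bar>"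
    by (intro add_mono sum_mono wavelet_p_Lipschitz s t)
       (use norm_power_diff[of s t "2 ^ J"] s t in auto)
  also have "(\<Sum>j\<le>J. 3 / 2 * 2 ^ j * \<bar>s - t\<bar>) = 3 / 2 * (2 ^ Suc J - 1) * \<bar>s - t\<bar>"
    by (induction J) (simp_all add: algebra_simps)
  \<comment> \<open>Origin of the final constant: the geometric sum gives at most
    \<open>3 * 2 ^ J\<close>, the low-pass function adds \<open>2 ^ J\<close>.\<close>
  also have "3 / 2 * (2 ^ Suc J - 1) * \<bar>s - t\<bar> + real (2 ^ J) * \<bar>s - t\<bar> \<le> 4 * 2 ^ J * \<bar>s - t\<bar>"
    by (simp add: algebra_simps)
  finally show ?thesis .
qed

section \<open>Euclidean, operator and family norms\<close>

lemma vec_norm2_square: "(vec_norm2 x)\<^sup>2 = (\<Sum>i<dim_vec x. (x $ i)\<^sup>2)"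
  unfolding vec_norm2_def scalar_prod_def
  by (simp add: sum_nonneg power2_eq_square lessThan_atLeast0)

lemma vec_norm2_nonneg [simp]: "0 \<le> vec_norm2 x"
  unfolding vec_norm2_def scalar_prod_def by (simp add: sum_nonneg)

lemma vec_norm2_unit_vec: "k < n \<Longrightarrow> vec_norm2 (unit_vec n k) = 1"
  by (simp add: vec_norm2_def)

lemma vec_norm2_orthogonal_mult:
  assumes V: "V \<in> carrier_mat n n" "transpose_mat V * V = 1\<^sub>m n" and x: "x \<in> carrier_vec n"
  shows "vec_norm2 (V *\<^sub>v x) = vec_norm2 x"
proof -
  have "(V *\<^sub>v x) \<bullet> (V *\<^sub>v x) = (transpose_mat V *\<^sub>v (V *\<^sub>v x)) \<bullet> x"
    by (rule transpose_vec_mult_scalar[symmetric]) (use V x in auto)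
  also have "transpose_mat V *\<^sub>v (V *\<^sub>v x) = (transpose_mat V * V) *\<^sub>v x"
    by (rule assoc_mult_mat_vec[symmetric]) (use V x in auto)
  finally show ?thesis
    using V x by (simp add: vec_norm2_def)
qed

text \<open>Cauchy-Schwarz in each row bounds the operator by its Frobenius norm. The sum is stated
  with columns outermost because the overlap matrix is later estimated column by column.\<close>

lemma vec_norm2_mult_square_le:
  assumes M: "M \<in> carrier_mat n n" and x: "x \<in> carrier_vec n"
  shows "(vec_norm2 (M *\<^sub>v x))\<^sup>2 \<le> (\<Sum>k<n. \<Sum>i<n. (M $$ (i, k))\<^sup>2) * (vec_norm2 x)\<^sup>2"
proof -
  have "(vec_norm2 (M *\<^sub>v x))\<^sup>2 = (\<Sum>i<n. (\<Sum>k<n. M $$ (i, k) * x $ k)\<^sup>2)"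
    unfolding vec_norm2_square
    using M x by (auto simp: scalar_prod_def lessThan_atLeast0 intro!: sum.cong)
  also have "\<dots> \<le> (\<Sum>i<n. (\<Sum>k<n. (M $$ (i, k))\<^sup>2) * (\<Sum>k<n. (x $ k)\<^sup>2))"
    by (intro sum_mono Cauchy_Schwarz_ineq_sum)
  also have "\<dots> = (\<Sum>i<n. \<Sum>k<n. (M $$ (i, k))\<^sup>2) * (vec_norm2 x)\<^sup>2"
    using x by (simp add: vec_norm2_square sum_distrib_right)
  also have "(\<Sum>i<n. \<Sum>k<n. (M $$ (i, k))\<^sup>2) = (\<Sum>k<n. \<Sum>i<n. (M $$ (i, k))\<^sup>2)"
    by (rule sum.swap)
  finally show ?thesis .
qed

text \<open>The supremum dominates its members only if the set is bounded above; the Frobenius norm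
  supplies such a bound.\<close>

lemma vec_norm2_mult_le_op_norm2:
  assumes B: "B \<in> carrier_mat n n" and x: "x \<in> carrier_vec n" "vec_norm2 x = 1"
  shows "vec_norm2 (B *\<^sub>v x) \<le> op_norm2 n B"
  unfolding op_norm2_def
proof (rule cSUP_upper)
  show "x \<in> {x \<in> carrier_vec n. vec_norm2 x = 1}"
    using x by simp
  show "bdd_above ((\<lambda>x. vec_norm2 (B *\<^sub>v x)) ` {x \<in> carrier_vec n. vec_norm2 x = 1})"
  proof (rule bdd_aboveI2)
    fix y assume y: "y \<in> {x \<in> carrier_vec n. vec_norm2 x = 1}"
    then show "vec_norm2 (B *\<^sub>v y) \<le> sqrt (\<Sum>k<n. \<Sum>i<n. (B $$ (i, k))\<^sup>2)"
      using vec_norm2_mult_square_le[OF B, of y] by (auto intro!: real_le_rsqrt)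
  qed
qed

lemma family_norm2_square_le:
  assumes n: "0 < n"
    and le: "\<And>x. x \<in> carrier_vec n \<Longrightarrow> vec_norm2 x = 1 \<Longrightarrow>
      (\<Sum>i\<in>I. (vec_norm2 (B i *\<^sub>v x))\<^sup>2) \<le> R"
  shows "(family_norm2 n I B)\<^sup>2 \<le> R"
proof -
  let ?X = "{x \<in> carrier_vec n. vec_norm2 x = 1}"
  let ?f = "\<lambda>x. sqrt (\<Sum>i\<in>I. (vec_norm2 (B i *\<^sub>v x))\<^sup>2)"
  \<comment> \<open>This vector makes the supremum range over a nonempty set, and it forces both the
    supremum and \<open>R\<close> to be nonnegative, so that squaring is monotone.\<close>
  have e: "unit_vec n 0 \<in> ?X"
    using n by (simp add: vec_norm2_unit_vec)
  have upper: "?f x \<le> sqrt R" if "x \<in> ?X" for x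
    using le[of x] that by simp
  have bdd: "bdd_above (?f ` ?X)"
    by (rule bdd_aboveI2[OF upper])
  have "0 \<le> ?f (unit_vec n 0)"
    by (simp add: sum_nonneg)
  also have "\<dots> \<le> family_norm2 n I B"
    unfolding family_norm2_def by (rule cSUP_upper[OF e bdd])
  finally have nonneg: "0 \<le> family_norm2 n I B" .
  have "0 \<le> (\<Sum>i\<in>I. (vec_norm2 (B i *\<^sub>v unit_vec n 0))\<^sup>2)"
    by (simp add: sum_nonneg)
  also have "\<dots> \<le> R"
    using le[of "unit_vec n 0"] e by simp
  finally have R: "0 \<le> R" .
  have "family_norm2 n I B \<le> sqrt R"
    unfolding family_norm2_def by (rule cSUP_least) (use e upper in blast)+
  then have "(family_norm2 n I B)\<^sup>2 \<le> (sqrt R)\<^sup>2"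
    by (rule power_mono) (rule nonneg)
  with R show ?thesis by simp
qed

section \<open>Comparing spectral matrices in two orthonormal bases\<close>

text \<open>Inserting \<open>V' * transpose_mat V'\<close> on the right of the first matrix and
  \<open>V * transpose_mat V\<close> on the left of the second gives both the outer factors
  \<open>V\<close> and \<open>transpose_mat V'\<close>. What remains inside is the overlap matrix,
  scaled by rows in one term and by columns in the other.\<close>

lemma spectral_mat_diff:
  assumes V: "V \<in> carrier_mat n n" "transpose_mat V * V = 1\<^sub>m n"
    and V': "V' \<in> carrier_mat n n" "transpose_mat V' * V' = 1\<^sub>m n"
  shows "spectral_mat n V \<mu> - spectral_mat n V' \<mu>' =
    V * mat n n (\<lambda>(i, k). (\<mu> i - \<mu>' k) * (transpose_mat V * V') $$ (i, k)) * transpose_mat V'"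
    (is "_ = V * ?M * _")
proof -
  note assoc = assoc_mult_mat[of _ n n _ n _ n] mult_carrier_mat[of _ n n _ n]
  have inv: "V * transpose_mat V = 1\<^sub>m n" "V' * transpose_mat V' = 1\<^sub>m n"
    using V V' by (auto intro!: mat_mult_left_right_inverse[of "transpose_mat _"])
  have cancel: "V * (transpose_mat V * X) = X" if "X \<in> carrier_mat n n" for X
    using assoc(1)[of V "transpose_mat V" X] V that inv by simp
  have C: "transpose_mat V * V' \<in> carrier_mat n n"
    using V V' by simp
  have "?M = mat_diag n \<mu> * (transpose_mat V * V') - transpose_mat V * V' * mat_diag n \<mu>'"
    unfolding mat_diag_mult_left[OF C] mat_diag_mult_right[OF C]
    by (intro eq_matI) (auto simp: algebra_simps)
  moreover have "V * (mat_diag n \<mu> * (transpose_mat V * V')) * transpose_mat V' = spectral_mat n V \<mu>"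
    using V V' inv by (simp add: spectral_mat_def assoc)
  moreover have "V * (transpose_mat V * V' * mat_diag n \<mu>') * transpose_mat V' = spectral_mat n V' \<mu>'"
    using V V' by (simp add: spectral_mat_def assoc cancel)
  moreover have "V * (X - Y) * transpose_mat V' = V * X * transpose_mat V' - V * Y * transpose_mat V'"
    if "X \<in> carrier_mat n n" "Y \<in> carrier_mat n n" for X Y
    using V V' that
    by (simp add: mult_minus_distrib_mat[of _ n n _ n] minus_mult_distrib_mat[of _ n n _ _ n] assoc(2))
  ultimately show ?thesis
    using C by (simp add: assoc(2))
qed

lemma sum_square_column_orthogonal:
  fixes U :: "real mat"
  assumes U: "U \<in> carrier_mat n n" "transpose_mat U * U = 1\<^sub>m n" and k: "k < n"
  shows "(\<Sum>i<n. (U $$ (i, k))\<^sup>2) = 1"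
proof -
  have "(transpose_mat U * U) $$ (k, k) = (\<Sum>i<n. (U $$ (i, k))\<^sup>2)"
    using U(1) k by (simp add: scalar_prod_def lessThan_atLeast0 power2_eq_square)
  then show ?thesis using U(2) k by simp
qed

lemma orthogonal_overlap:
  fixes V V' :: "real mat"
  assumes V: "V \<in> carrier_mat n n" "transpose_mat V * V = 1\<^sub>m n"
    and V': "V' \<in> carrier_mat n n" "transpose_mat V' * V' = 1\<^sub>m n"
  shows "transpose_mat (transpose_mat V * V') * (transpose_mat V * V') = 1\<^sub>m n"
proof -
  note assoc = assoc_mult_mat[of _ n n _ n _ n] mult_carrier_mat[of _ n n _ n]
  have inv: "V * transpose_mat V = 1\<^sub>m n"
    using V by (auto intro!: mat_mult_left_right_inverse[of "transpose_mat _"])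
  have "V * (transpose_mat V * V') = V'"
    using assoc(1)[of V "transpose_mat V" V'] V V' inv by simp
  then show ?thesis
    using V V' by (simp add: transpose_mult[of _ n n _ n] assoc)
qed

text \<open>The outer orthogonal factors preserve norms, so the Frobenius bound applies to the inner
  matrix. Being a sum over entries, it allows scalar estimates for each pair of eigenvalues.\<close>

lemma spectral_mat_diff_Frobenius:
  assumes V: "V \<in> carrier_mat n n" "transpose_mat V * V = 1\<^sub>m n"
    and V': "V' \<in> carrier_mat n n" "transpose_mat V' * V' = 1\<^sub>m n"
    and x: "x \<in> carrier_vec n" "vec_norm2 x = 1"
  shows "(vec_norm2 ((spectral_mat n V \<mu> - spectral_mat n V' \<mu>') *\<^sub>v x))\<^sup>2
    \<le> (\<Sum>k<n. \<Sum>i<n. (\<mu> i - \<mu>' k)\<^sup>2 * ((transpose_mat V * V') $$ (i, k))\<^sup>2)"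
proof -
  define M where "M = mat n n (\<lambda>(i, k). (\<mu> i - \<mu>' k) * (transpose_mat V * V') $$ (i, k))"
  have M: "M \<in> carrier_mat n n" by (simp add: M_def)
  have inv: "V' * transpose_mat V' = 1\<^sub>m n"
    using V' by (auto intro!: mat_mult_left_right_inverse[of "transpose_mat _"])
  let ?y = "transpose_mat V' *\<^sub>v x"
  have y: "?y \<in> carrier_vec n" using V' x by simp
  have normy: "vec_norm2 ?y = 1"
    using vec_norm2_orthogonal_mult[of "transpose_mat V'" n x] V' x inv by simp
  have "(spectral_mat n V \<mu> - spectral_mat n V' \<mu>') *\<^sub>v x = V *\<^sub>v (M *\<^sub>v ?y)"
    unfolding spectral_mat_diff[OF V V'] M_def[symmetric]
    using V V' M x by (simp add: assoc_mult_mat_vec[of _ n n _ n])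
  then have "(vec_norm2 ((spectral_mat n V \<mu> - spectral_mat n V' \<mu>') *\<^sub>v x))\<^sup>2
      = (vec_norm2 (M *\<^sub>v ?y))\<^sup>2"
    using vec_norm2_orthogonal_mult[OF V, of "M *\<^sub>v ?y"] M y by simp
  also have "\<dots> \<le> (\<Sum>k<n. \<Sum>i<n. (M $$ (i, k))\<^sup>2)"
    using vec_norm2_mult_square_le[OF M y] normy by simp
  also have "\<dots> = (\<Sum>k<n. \<Sum>i<n. (\<mu> i - \<mu>' k)\<^sup>2 * ((transpose_mat V * V') $$ (i, k))\<^sup>2)"
    by (intro sum.cong) (simp_all add: M_def power_mult_distrib)
  finally show ?thesis .
qed

text \<open>The test vector is column \<open>k\<close> of \<open>V'\<close>: rotated back it is a
  unit vector, which picks out column \<open>k\<close> of the inner matrix.\<close>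

lemma spectral_mat_diff_column_le_op_norm2:
  assumes V: "V \<in> carrier_mat n n" "transpose_mat V * V = 1\<^sub>m n"
    and V': "V' \<in> carrier_mat n n" "transpose_mat V' * V' = 1\<^sub>m n"
    and k: "k < n"
  shows "(\<Sum>i<n. (\<mu> i - \<mu>' k)\<^sup>2 * ((transpose_mat V * V') $$ (i, k))\<^sup>2)
    \<le> (op_norm2 n (spectral_mat n V \<mu> - spectral_mat n V' \<mu>'))\<^sup>2"
proof -
  define M where "M = mat n n (\<lambda>(i, k). (\<mu> i - \<mu>' k) * (transpose_mat V * V') $$ (i, k))"
  let ?B = "spectral_mat n V \<mu> - spectral_mat n V' \<mu>'"
  let ?e = "unit_vec n k :: real vec"
  have M: "M \<in> carrier_mat n n" by (simp add: M_def)
  have B: "?B \<in> carrier_mat n n"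
    using V V' unfolding spectral_mat_def by auto
  have cancel: "transpose_mat V' *\<^sub>v (V' *\<^sub>v ?e) = ?e"
    using assoc_mult_mat_vec[of "transpose_mat V'" n n V' n ?e] V' by simp
  have "?B *\<^sub>v (V' *\<^sub>v ?e) = V *\<^sub>v (M *\<^sub>v ?e)"
    unfolding spectral_mat_diff[OF V V'] M_def[symmetric]
    using V V' M cancel by (simp add: assoc_mult_mat_vec[of _ n n _ n])
  then have "vec_norm2 (?B *\<^sub>v (V' *\<^sub>v ?e)) = vec_norm2 (M *\<^sub>v ?e)"
    using vec_norm2_orthogonal_mult[OF V, of "M *\<^sub>v ?e"] M by simp
  moreover have "M *\<^sub>v ?e = col M k"
    using M k by (intro eq_vecI) auto
  moreover have "vec_norm2 (?B *\<^sub>v (V' *\<^sub>v ?e)) \<le> op_norm2 n ?B"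
    using vec_norm2_orthogonal_mult[OF V', of ?e] V' k
    by (intro vec_norm2_mult_le_op_norm2 B) (simp_all add: vec_norm2_unit_vec)
  ultimately have "(vec_norm2 (col M k))\<^sup>2 \<le> (op_norm2 n ?B)\<^sup>2"
    by (intro power_mono) simp_all
  then show ?thesis
    using k by (simp add: vec_norm2_square M_def power_mult_distrib)
qed

lemma spectral_mat_diff_sum_abs_le:
  assumes V: "V \<in> carrier_mat n n" "transpose_mat V * V = 1\<^sub>m n"
    and V': "V' \<in> carrier_mat n n" "transpose_mat V' * V' = 1\<^sub>m n"
  shows "(\<Sum>k<n. \<Sum>i<n. \<bar>\<mu> i - \<mu>' k\<bar> * ((transpose_mat V * V') $$ (i, k))\<^sup>2)
    \<le> real n * op_norm2 n (spectral_mat n V \<mu> - spectral_mat n V' \<mu>')"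
proof -
  define C where "C = transpose_mat V * V'"
  let ?B = "spectral_mat n V \<mu> - spectral_mat n V' \<mu>'"
  have C: "C \<in> carrier_mat n n" "transpose_mat C * C = 1\<^sub>m n"
    using orthogonal_overlap[OF V V'] V V' by (simp_all add: C_def)
  have B: "?B \<in> carrier_mat n n"
    using V V' unfolding spectral_mat_def by auto
  have "(\<Sum>i<n. \<bar>\<mu> i - \<mu>' k\<bar> * (C $$ (i, k))\<^sup>2) \<le> op_norm2 n ?B" if k: "k < n" for k
  proof (rule power2_le_imp_le)
    \<comment> \<open>The weight is split into two equal factors: one joins the eigenvalue
      difference to form a column norm, the other has squares summing to 1 because \<open>C\<close>
      is orthogonal.\<close>
    have "(\<Sum>i<n. \<bar>\<mu> i - \<mu>' k\<bar> * (C $$ (i, k))\<^sup>2)\<^sup>2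
        = (\<Sum>i<n. (\<bar>\<mu> i - \<mu>' k\<bar> * \<bar>C $$ (i, k)\<bar>) * \<bar>C $$ (i, k)\<bar>)\<^sup>2"
      by (simp add: power2_eq_square mult.assoc)
    also have "\<dots> \<le> (\<Sum>i<n. (\<bar>\<mu> i - \<mu>' k\<bar> * \<bar>C $$ (i, k)\<bar>)\<^sup>2) * (\<Sum>i<n. \<bar>C $$ (i, k)\<bar>\<^sup>2)"
      by (rule Cauchy_Schwarz_ineq_sum)
    also have "\<dots> = (\<Sum>i<n. (\<mu> i - \<mu>' k)\<^sup>2 * (C $$ (i, k))\<^sup>2)"
      using sum_square_column_orthogonal[OF C k] by (simp add: power_mult_distrib)
    also have "\<dots> \<le> (op_norm2 n ?B)\<^sup>2"
      unfolding C_def by (rule spectral_mat_diff_column_le_op_norm2[OF V V' k])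
    finally show "(\<Sum>i<n. \<bar>\<mu> i - \<mu>' k\<bar> * (C $$ (i, k))\<^sup>2)\<^sup>2 \<le> (op_norm2 n ?B)\<^sup>2" .
    show "0 \<le> op_norm2 n ?B"
      using vec_norm2_mult_le_op_norm2[OF B, of "unit_vec n k"] k
      by (auto simp: vec_norm2_unit_vec intro: order_trans[rotated])
  qed
  then show ?thesis
    using sum_bounded_above[of "{..<n}" "\<lambda>k. \<Sum>i<n. \<bar>\<mu> i - \<mu>' k\<bar> * (C $$ (i, k))\<^sup>2" "op_norm2 n ?B"]
    by (simp add: C_def)
qed

section \<open>Location of the Laplacian spectrum\<close>

lemma abs_normalized_adjacency_form_le:
  fixes A :: "nat \<Rightarrow> nat \<Rightarrow> real" and v :: "nat \<Rightarrow> real"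
  assumes nonneg: "\<And>i j. i < n \<Longrightarrow> j < n \<Longrightarrow> 0 \<le> A i j"
    and sym: "\<And>i j. i < n \<Longrightarrow> j < n \<Longrightarrow> A i j = A j i"
    and r: "\<And>i. i < n \<Longrightarrow> (\<Sum>j<n. A i j) * (r i)\<^sup>2 \<le> 1"
  shows "\<bar>\<Sum>i<n. \<Sum>j<n. v i * (r i * A i j * r j) * v j\<bar> \<le> (\<Sum>i<n. (v i)\<^sup>2)"
proof -
  define u where "u i = r i * v i" for i
  \<comment> \<open>The second half carries \<open>A j i\<close>, so exchanging the two summations
    turns it into the first half and only row sums remain.\<close>
  have amgm: "\<bar>A i j * (u i * u j)\<bar> \<le> A i j * (u i)\<^sup>2 / 2 + A j i * (u j)\<^sup>2 / 2"
    if "i < n" "j < n" for i j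
  proof -
    have "2 * \<bar>u i * u j\<bar> \<le> (u i)\<^sup>2 + (u j)\<^sup>2"
      using sum_squares_bound[of "\<bar>u i\<bar>" "\<bar>u j\<bar>"] by (simp add: abs_mult)
    then have "A i j * (2 * \<bar>u i * u j\<bar>) \<le> A i j * ((u i)\<^sup>2 + (u j)\<^sup>2)"
      using nonneg that by (intro mult_left_mono) auto
    then show ?thesis
      using nonneg[OF that] sym[OF that] by (simp add: abs_mult algebra_simps)
  qed
  have "\<bar>\<Sum>i<n. \<Sum>j<n. v i * (r i * A i j * r j) * v j\<bar> = \<bar>\<Sum>i<n. \<Sum>j<n. A i j * (u i * u j)\<bar>"
    by (simp add: u_def algebra_simps)
  also have "\<dots> \<le> (\<Sum>i<n. \<Sum>j<n. \<bar>A i j * (u i * u j)\<bar>)"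
    by (intro order_trans[OF sum_abs] sum_mono order_refl)
  also have "\<dots> \<le> (\<Sum>i<n. \<Sum>j<n. A i j * (u i)\<^sup>2 / 2 + A j i * (u j)\<^sup>2 / 2)"
    by (intro sum_mono amgm) auto
  also have "\<dots> = (\<Sum>i<n. \<Sum>j<n. A i j * (u i)\<^sup>2 / 2) + (\<Sum>i<n. \<Sum>j<n. A j i * (u j)\<^sup>2 / 2)"
    by (simp add: sum.distrib)
  also have "(\<Sum>i<n. \<Sum>j<n. A j i * (u j)\<^sup>2 / 2) = (\<Sum>i<n. \<Sum>j<n. A i j * (u i)\<^sup>2 / 2)"
    by (rule sum.swap)
  also have "(\<Sum>i<n. \<Sum>j<n. A i j * (u i)\<^sup>2 / 2) + (\<Sum>i<n. \<Sum>j<n. A i j * (u i)\<^sup>2 / 2)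
      = (\<Sum>i<n. ((\<Sum>j<n. A i j) * (r i)\<^sup>2) * (v i)\<^sup>2)"
    by (simp add: u_def sum_distrib_right sum_divide_distrib[symmetric] power_mult_distrib mult.assoc)
  also have "\<dots> \<le> (\<Sum>i<n. 1 * (v i)\<^sup>2)"
    by (intro sum_mono mult_right_mono r) auto
  finally show ?thesis by simp
qed

text \<open>Pairing the eigenvalue equation with \<open>v\<close> gives the Rayleigh identity, in
  which the normalized adjacency form is at most the squared norm of \<open>v\<close> in absolute
  value.\<close>

lemma normalized_laplacian_eigenvalue_bounds:
  assumes G: "weighted_connected_graph n E W"
    and ev: "eigenvector (normalized_laplacian n E W) v \<omega>"
  shows "\<omega> \<in> {0..2}"
proof -
  define A where "A i j = weighted_adjacency n E W $$ (i, j)" for i j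
  define r where "r i = 1 / sqrt (weighted_degree n E W $ i)" for i
  have Acar: "weighted_adjacency n E W \<in> carrier_mat n n"
    by (simp add: weighted_adjacency_def)
  define S where "S = mat_diag n r * weighted_adjacency n E W * mat_diag n r"
  have S: "S \<in> carrier_mat n n"
    using Acar by (simp add: S_def mult_carrier_mat[of _ n n _ n])
  have Sij: "S $$ (i, j) = r i * A i j * r j" if "i < n" "j < n" for i j
    using that mat_diag_mult_left[OF Acar, of r]
    by (simp add: S_def A_def mat_diag_mult_right[of _ n n])
  have N: "normalized_laplacian n E W = 1\<^sub>m n - S"
    by (simp add: normalized_laplacian_def S_def r_def[abs_def] Let_def)
  have v: "v \<in> carrier_vec n" "v \<noteq> 0\<^sub>v n" "(1\<^sub>m n - S) *\<^sub>v v = \<omega> \<cdot>\<^sub>v v"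
    using ev S unfolding eigenvector_def N by auto
  have nonneg: "0 \<le> A i j" and sym: "A i j = A j i" if "i < n" "j < n" for i j
    using G that unfolding weighted_connected_graph_def A_def weighted_adjacency_def
    by (fastforce simp: sym_def)+
  \<comment> \<open>The product is 1 for positive degree; for degree 0 division by zero makes
    \<open>r i\<close> and the product 0, hence an inequality.\<close>
  have r: "(\<Sum>j<n. A i j) * (r i)\<^sup>2 \<le> 1" if "i < n" for i
  proof -
    have "weighted_degree n E W $ i = (\<Sum>j<n. A i j)"
      using that by (simp add: weighted_degree_def A_def)
    moreover have "0 \<le> (\<Sum>j<n. A i j)"
      using nonneg that by (intro sum_nonneg) auto
    ultimately show ?thesis
      by (simp add: r_def power_divide)
  qed
  let ?s = "\<Sum>i<n. (v $ i)\<^sup>2"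
  have "v - S *\<^sub>v v = \<omega> \<cdot>\<^sub>v v"
    using v S minus_mult_distrib_mat_vec[of "1\<^sub>m n" n n S v] by simp
  then have "v \<bullet> (\<omega> \<cdot>\<^sub>v v) = v \<bullet> (v - S *\<^sub>v v)"
    by simp
  also have "\<dots> = v \<bullet> v - v \<bullet> (S *\<^sub>v v)"
    by (rule scalar_prod_minus_distrib[of _ n]) (use v S in auto)
  also have "v \<bullet> (S *\<^sub>v v) = (\<Sum>i<n. \<Sum>j<n. v $ i * (r i * A i j * r j) * v $ j)"
    using v S by (simp add: scalar_prod_def lessThan_atLeast0 Sij sum_distrib_left mult.assoc)
  finally have "\<omega> * ?s = ?s - (\<Sum>i<n. \<Sum>j<n. v $ i * (r i * A i j * r j) * v $ j)"
    using v by (simp add: scalar_prod_def lessThan_atLeast0 power2_eq_square sum_distrib_left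
        mult.left_commute)
  moreover have "\<bar>\<Sum>i<n. \<Sum>j<n. v $ i * (r i * A i j * r j) * v $ j\<bar> \<le> ?s"
    by (rule abs_normalized_adjacency_form_le[OF nonneg sym r])
  ultimately have bounds: "0 \<le> \<omega> * ?s" "\<omega> * ?s \<le> 2 * ?s"
    by linarith+
  obtain i where "i < n" "v $ i \<noteq> 0"
    using v(1,2) by (metis carrier_vecD eq_vecI index_zero_vec)
  then have "0 < ?s"
    by (intro sum_pos2[of _ i]) auto
  with bounds show ?thesis
    by (simp add: zero_le_mult_iff)
qed

section \<open>The bound for the wavelet families\<close>

lemma laplacian_eigenbasis_orthogonal:
  assumes "laplacian_eigenbasis n E W \<omega> V"
  shows "V \<in> carrier_mat n n" "transpose_mat V * V = 1\<^sub>m n"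
  using assms by (simp_all add: laplacian_eigenbasis_def)

lemma profile_eigenvalue_bounds:
  assumes "spectral_profile g" "weighted_connected_graph n E W"
    and "laplacian_eigenbasis n E W \<omega> V" and "i < n"
  shows "0 \<le> g (\<omega> i)" "g (\<omega> i) \<le> 1"
proof -
  have "\<omega> i \<in> {0..2}"
    using assms(3,4)
    by (intro normalized_laplacian_eigenvalue_bounds[OF assms(2), of "col V i"])
       (simp add: laplacian_eigenbasis_def)
  then have "g (\<omega> i) \<in> {0..1}"
    using assms(1) unfolding spectral_profile_def by blast
  then show "0 \<le> g (\<omega> i)" "g (\<omega> i) \<le> 1"
    by simp_all
qed

text \<open>The graphs have been abstracted away: two orthogonal matrices and spectral values in the
  unit interval remain.\<close>

lemma wavelets_family_diff_le:
  assumes V: "V \<in> carrier_mat n n" "transpose_mat V * V = 1\<^sub>m n"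
    and V': "V' \<in> carrier_mat n n" "transpose_mat V' * V' = 1\<^sub>m n"
    and lam: "\<And>i. i < n \<Longrightarrow> 0 \<le> lam i" "\<And>i. i < n \<Longrightarrow> lam i \<le> 1"
    and lam': "\<And>i. i < n \<Longrightarrow> 0 \<le> lam' i" "\<And>i. i < n \<Longrightarrow> lam' i \<le> 1"
    and n: "0 < n"
  shows "(family_norm2 n {..J + 1} (\<lambda>j. wavelets n V lam J j - wavelets n V' lam' J j))\<^sup>2
    \<le> 4 * 2 ^ J * real n * op_norm2 n (spectral_mat n V lam - spectral_mat n V' lam')"
proof (rule family_norm2_square_le[OF n])
  fix x :: "real vec"
  assume x: "x \<in> carrier_vec n" "vec_norm2 x = 1"
  define c where "c i k = ((transpose_mat V * V') $$ (i, k))\<^sup>2" for i k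
  let ?q = "wavelet_q J"
  have "(\<Sum>j\<le>J + 1. (vec_norm2 ((wavelets n V lam J j - wavelets n V' lam' J j) *\<^sub>v x))\<^sup>2)
      \<le> (\<Sum>j\<le>J + 1. \<Sum>k<n. \<Sum>i<n. (?q j (lam i) - ?q j (lam' k))\<^sup>2 * c i k)"
    unfolding wavelets_def c_def
    by (intro sum_mono spectral_mat_diff_Frobenius V V' x)
  \<comment> \<open>The weight \<open>c i k\<close> is the same for all \<open>j\<close>, so the
    scales can be summed first for each fixed pair of eigenvalues.\<close>
  also have "\<dots> = (\<Sum>k<n. \<Sum>i<n. (\<Sum>j\<le>J + 1. (?q j (lam i) - ?q j (lam' k))\<^sup>2) * c i k)"
    unfolding sum_distrib_right by (subst sum.swap) (intro sum.cong refl sum.swap)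
  also have "\<dots> \<le> (\<Sum>k<n. \<Sum>i<n. 4 * 2 ^ J * \<bar>lam i - lam' k\<bar> * c i k)"
    by (intro sum_mono mult_right_mono wavelet_q_square_Lipschitz)
       (auto simp: c_def lam lam')
  also have "\<dots> = 4 * 2 ^ J * (\<Sum>k<n. \<Sum>i<n. \<bar>lam i - lam' k\<bar> * c i k)"
    by (simp add: sum_distrib_left mult.assoc)
  also have "\<dots> \<le> 4 * 2 ^ J * (real n * op_norm2 n (spectral_mat n V lam - spectral_mat n V' lam'))"
    unfolding c_def by (intro mult_left_mono spectral_mat_diff_sum_abs_le V V') auto
  finally show "(\<Sum>j\<le>J + 1. (vec_norm2 ((wavelets n V lam J j - wavelets n V' lam' J j) *\<^sub>v x))\<^sup>2)
      \<le> 4 * 2 ^ J * real n * op_norm2 n (spectral_mat n V lam - spectral_mat n V' lam')"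
    by (simp add: mult.assoc)
qed

theorem theorem4p1:
  "\<exists>C :: real \<Rightarrow> real.
     \<forall>(n :: nat) (J :: nat) (g :: real \<Rightarrow> real)
       (E :: (nat \<times> nat) set) (W :: nat \<Rightarrow> nat \<Rightarrow> real) (\<omega> :: nat \<Rightarrow> real) (V :: real mat)
       (E' :: (nat \<times> nat) set) (W' :: nat \<Rightarrow> nat \<Rightarrow> real) (\<omega>' :: nat \<Rightarrow> real) (V' :: real mat).
       n \<ge> 2 \<longrightarrow> spectral_profile g \<longrightarrow>
       weighted_connected_graph n E W \<longrightarrow> laplacian_eigenbasis n E W \<omega> V \<longrightarrow>
       weighted_connected_graph n E' W' \<longrightarrow> laplacian_eigenbasis n E' W' \<omega>' V' \<longrightarrow>
       (let lam = (\<lambda>i. g (\<omega> i)); lam' = (\<lambda>i. g (\<omega>' i));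
            T = spectral_mat n V lam; T' = spectral_mat n V' lam';
            lam1_max = max (lam 1) (lam' 1)
        in (family_norm2 n {..J + 1} (\<lambda>j. wavelets n V lam J j - wavelets n V' lam' J j))\<^sup>2
             \<le> C lam1_max * 2 ^ J * real n * op_norm2 n (T - T'))"
  unfolding Let_def
  \<comment> \<open>The witness is a constant function, since the estimate is uniform in the
    spectral values.\<close>
  by (rule exI[of _ "\<lambda>_. 4"], intro allI impI wavelets_family_diff_le)
     (auto intro: laplacian_eigenbasis_orthogonal profile_eigenvalue_bounds)

end
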